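(* Let $C$ be a DNNF circuit. Then the linear system $\mathcal{S}_y(C)$ is totally dual integral and the polyhedron $\mathcal{P}_y(C)=\{y : y\text{ satisfies }\mathcal{S}_y(C)\}$ is integral.
   Context: An NNF circuit $C$ on a finite variable set $V$ is a finite directed acyclic graph with a designated output node $o$, in which every node (gate) of in-degree $0$ (an input) is labeled by $0$, $1$, or a literal $v$ or $\neg v$ with $v\in V$, and every other gate is labeled $\wedge$ or $\vee$. $\mathrm{var}(g)$ is the set of variables $v$ such that there is a (possibly trivial) path from an input labeled $v$ or $\neg v$ to $g$. $C$ is a DNNF if for every $\wedge$-gate $g$ and distinct gates $h,h'$ with edges $h\to g$, $h'\to g$, one has $\mathrm{var}(h)\cap\mathrm{var}(h')=\emptyset$. Standing normalization: $C$ is smooth (for every $\vee$-gate $g$ and edge $h\to g$, $\mathrm{var}(h)=\mathrm{var}(g)$), the output gate $o$ is a $\vee$-gate with no outgoing edges, there is a directed path from every gate to $o$, and for each literal $\ell$ there is at most one input labeled $\ell$. Let $\mathrm{edges}(C)$ be the set of edges of $C$, $\mathrm{in}_E(g)$ the set of edges going into $g$ and $\mathrm{out}_E(g)$ the set of edges going out of $g$. The system $\mathcal{S}_y(C)$ in variables $(y_e)_{e\in\mathrm{edges}(C)}$ is: (1) $\sum_{e\in\mathrm{in}_E(o)}y_e=1$; (2) $\sum_{e\in\mathrm{in}_E(g)}y_e-\sum_{f\in\mathrm{out}_E(g)}y_f=0$ for every $\vee$-gate $g\ne o$; (3) $y_e-\sum_{f\in\mathrm{out}_E(g)}y_f=0$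 for every $\wedge$-gate $g$ and every $e\in\mathrm{in}_E(g)$; (4) $y_e\ge0$ for every $e\in\mathrm{edges}(C)$. A rational system $Ay=b,\ y\ge0$ is totally dual integral if the minimum in the LP-duality equation $\max\{c^{\mathsf T}y: Ay=b,\ y\ge0\}=\min\{z^{\mathsf T}b: zA\ge c\}$ has an integral optimal solution $z$ for each integral vector $c$ for which the minimum is finite. A polyhedron is integral if it is the convex hull of its integral points. *)

theory Defs
  imports "HOL-Analysis.Analysis" "HOL-Analysis.Finite_Function_Topology"
begin

section \<open>NNF and DNNF circuits\<close>

datatype 'v literal = Pos 'v | Neg 'v

datatype 'v gate_label = Const bool | Lit "'v literal" | And_Gate | Or_Gate

record ('g, 'v) circuit =
  circ_vars :: "'v set"
  gates :: "'g set"
  edges :: "('g \<times> 'g) set"  \<comment> \<open>\<open>(h, g)\<close> is the edge \<open>h \<rightarrow> g\<close>\<close>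
  label :: "'g \<Rightarrow> 'v gate_label"
  outgate :: 'g

definition in_edges :: "('g, 'v) circuit \<Rightarrow> 'g \<Rightarrow> ('g \<times> 'g) set" where
  "in_edges C g = {e \<in> edges C. snd e = g}"

definition out_edges :: "('g, 'v) circuit \<Rightarrow> 'g \<Rightarrow> ('g \<times> 'g) set" where
  "out_edges C g = {e \<in> edges C. fst e = g}"

definition input_labels :: "'v set \<Rightarrow> 'v gate_label set" where
  "input_labels V = range Const \<union> (Lit \<circ> Pos) ` V \<union> (Lit \<circ> Neg) ` V"

definition nnf_circuit :: "('g, 'v) circuit \<Rightarrow> bool" where
  "nnf_circuit C \<longleftrightarrow>
     finite (circ_vars C) \<and> finite (gates C) \<and> edges C \<subseteq> gates C \<times> gates C \<and>
     acyclic (edges C) \<and> outgate C \<in> gates C \<and>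
     (\<forall>g\<in>gates C.
        if in_edges C g = {} then label C g \<in> input_labels (circ_vars C)
        else label C g \<in> {And_Gate, Or_Gate})"

definition gate_vars :: "('g, 'v) circuit \<Rightarrow> 'g \<Rightarrow> 'v set" where
  "gate_vars C g =
     {v. \<exists>i\<in>gates C. label C i \<in> {Lit (Pos v), Lit (Neg v)} \<and> (i, g) \<in> (edges C)\<^sup>*}"

definition dnnf :: "('g, 'v) circuit \<Rightarrow> bool" where
  "dnnf C \<longleftrightarrow> nnf_circuit C \<and>
     (\<forall>g\<in>gates C. label C g = And_Gate \<longrightarrow>
        (\<forall>h h'. (h, g) \<in> edges C \<and> (h', g) \<in> edges C \<and> h \<noteq> h' \<longrightarrow>
           gate_vars C h \<inter> gate_vars C h' = {}))"

definition smooth :: "('g, 'v) circuit \<Rightarrow> bool" where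
  "smooth C \<longleftrightarrow>
     (\<forall>g\<in>gates C. label C g = Or_Gate \<longrightarrow>
        (\<forall>h. (h, g) \<in> edges C \<longrightarrow> gate_vars C h = gate_vars C g))"

definition normalized :: "('g, 'v) circuit \<Rightarrow> bool" where
  "normalized C \<longleftrightarrow>
     smooth C \<and>
     label C (outgate C) = Or_Gate \<and> out_edges C (outgate C) = {} \<and>
     (\<forall>g\<in>gates C. (g, outgate C) \<in> (edges C)\<^sup>*) \<and>
     (\<forall>l. \<forall>i\<in>gates C. \<forall>j\<in>gates C. label C i = Lit l \<and> label C j = Lit l \<longrightarrow> i = j)"

section \<open>Linear systems \<open>A y = b, y \<ge> 0\<close>, total dual integrality, integral polyhedra\<close>

text \<open>
  The rows of \<open>A\<close> are indexed by \<open>eqs S\<close> and its columns by \<open>unknowns S\<close>. The values of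
  \<open>coeff\<close> and \<open>rhs\<close> outside these index sets are irrelevant.
\<close>

record ('r, 'x) linsys =
  eqs :: "'r set"
  unknowns :: "'x set"
  coeff :: "'r \<Rightarrow> 'x \<Rightarrow> real"
  rhs :: "'r \<Rightarrow> real"

definition rational_linsys :: "('r, 'x) linsys \<Rightarrow> bool" where
  "rational_linsys S \<longleftrightarrow>
     finite (eqs S) \<and> finite (unknowns S) \<and>
     (\<forall>r\<in>eqs S. rhs S r \<in> \<rat> \<and> (\<forall>x\<in>unknowns S. coeff S r x \<in> \<rat>))"

text \<open>
  The real vector space with coordinates indexed by the finite set \<open>X = unknowns S\<close> is the
  subspace of those \<^typ>\<open>'x \<Rightarrow>\<^sub>0 real\<close> whose support is contained in \<open>X\<close>.
\<close>

definition solutions :: "('r, 'x) linsys \<Rightarrow> ('x \<Rightarrow>\<^sub>0 real) set" where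
  "solutions S =
     {y. Poly_Mapping.keys y \<subseteq> unknowns S \<and>
         (\<forall>r\<in>eqs S. (\<Sum>x\<in>unknowns S. coeff S r x * Poly_Mapping.lookup y x) = rhs S r) \<and>
         (\<forall>x\<in>unknowns S. 0 \<le> Poly_Mapping.lookup y x)}"

definition dual_feasible :: "('r, 'x) linsys \<Rightarrow> ('x \<Rightarrow> int) \<Rightarrow> ('r \<Rightarrow> real) set" where
  "dual_feasible S c =
     {z. \<forall>x\<in>unknowns S. of_int (c x) \<le> (\<Sum>r\<in>eqs S. z r * coeff S r x)}"

definition dual_value :: "('r, 'x) linsys \<Rightarrow> ('r \<Rightarrow> real) \<Rightarrow> real" where
  "dual_value S z = (\<Sum>r\<in>eqs S. z r * rhs S r)"

text \<open>
  The minimum of the dual program counts as finite if the program is feasible and its objective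
  is bounded below (an infeasible program has minimum \<open>+\<infinity>\<close>).
\<close>

definition dual_min_finite :: "('r, 'x) linsys \<Rightarrow> ('x \<Rightarrow> int) \<Rightarrow> bool" where
  "dual_min_finite S c \<longleftrightarrow>
     dual_feasible S c \<noteq> {} \<and> bdd_below (dual_value S ` dual_feasible S c)"

definition dual_optimal :: "('r, 'x) linsys \<Rightarrow> ('x \<Rightarrow> int) \<Rightarrow> ('r \<Rightarrow> real) \<Rightarrow> bool" where
  "dual_optimal S c z \<longleftrightarrow>
     z \<in> dual_feasible S c \<and> (\<forall>z'\<in>dual_feasible S c. dual_value S z \<le> dual_value S z')"

definition totally_dual_integral :: "('r, 'x) linsys \<Rightarrow> bool" where
  "totally_dual_integral S \<longleftrightarrow>
     rational_linsys S \<and>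
     (\<forall>c. dual_min_finite S c \<longrightarrow> (\<exists>z. dual_optimal S c z \<and> (\<forall>r\<in>eqs S. z r \<in> \<int>)))"

definition integral_polyhedron :: "('x \<Rightarrow>\<^sub>0 real) set \<Rightarrow> bool" where
  "integral_polyhedron P \<longleftrightarrow>
     P = convex hull {y \<in> P. \<forall>x. Poly_Mapping.lookup y x \<in> \<int>}"

section \<open>The linear system of a circuit\<close>

text \<open>
  \<open>Root\<close> is the equation at the output gate, \<open>Or_Eq g\<close> the equation of an \<open>\<or>\<close>-gate
  \<open>g\<close> other than the output, and \<open>And_Eq e\<close> the equation of the \<open>\<and>\<close>-gate
  \<open>g = snd e\<close> and its incoming edge \<open>e\<close>.
\<close>

datatype 'g eq_index = Root | Or_Eq 'g | And_Eq "'g \<times> 'g"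

fun Sy_coeff :: "('g, 'v) circuit \<Rightarrow> 'g eq_index \<Rightarrow> 'g \<times> 'g \<Rightarrow> real" where
  "Sy_coeff C Root f = of_bool (f \<in> in_edges C (outgate C))"
| "Sy_coeff C (Or_Eq g) f = of_bool (f \<in> in_edges C g) - of_bool (f \<in> out_edges C g)"
| "Sy_coeff C (And_Eq e) f = of_bool (f = e) - of_bool (f \<in> out_edges C (snd e))"

definition Sy :: "('g, 'v) circuit \<Rightarrow> ('g eq_index, 'g \<times> 'g) linsys" where
  "Sy C =
    \<lparr>eqs = {Root}
       \<union> Or_Eq ` {g \<in> gates C. label C g = Or_Gate \<and> g \<noteq> outgate C}
       \<union> And_Eq ` (\<Union>g\<in>{g \<in> gates C. label C g = And_Gate}. in_edges C g),
     unknowns = edges C,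
     coeff = Sy_coeff C,
     rhs = (\<lambda>r. if r = Root then 1 else 0)\<rparr>"

definition Py :: "('g, 'v) circuit \<Rightarrow> ('g \<times> 'g \<Rightarrow>\<^sub>0 real) set" where
  "Py C = solutions (Sy C)"

lemma sum_of_bool_mult:
  fixes f :: "'x \<Rightarrow> real"
  assumes "finite A" "B \<subseteq> A"
  shows "(\<Sum>x\<in>A. of_bool (x \<in> B) * f x) = sum f B"
proof -
  have "(\<Sum>x\<in>A. of_bool (x \<in> B) * f x) = (\<Sum>x\<in>A. if x \<in> B then f x else 0)"
    by (rule sum.cong) auto
  also have "\<dots> = sum f B"
    using assms by (simp add: sum.inter_restrict[symmetric] Int_absorb1)
  finally show ?thesis .
qed

text \<open>The matrix form of the system spelled out as sums over incoming and outgoing edges.\<close>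

lemma mem_Py_iff:
  assumes "finite (edges C)"
  shows "y \<in> Py C \<longleftrightarrow>
    Poly_Mapping.keys y \<subseteq> edges C \<and>
    (\<Sum>e\<in>in_edges C (outgate C). Poly_Mapping.lookup y e) = 1 \<and>
    (\<forall>g\<in>gates C. label C g = Or_Gate \<and> g \<noteq> outgate C \<longrightarrow>
       (\<Sum>e\<in>in_edges C g. Poly_Mapping.lookup y e)
         - (\<Sum>f\<in>out_edges C g. Poly_Mapping.lookup y f) = 0) \<and>
    (\<forall>g\<in>gates C. label C g = And_Gate \<longrightarrow>
       (\<forall>e\<in>in_edges C g. Poly_Mapping.lookup y e
         - (\<Sum>f\<in>out_edges C g. Poly_Mapping.lookup y f) = 0)) \<and>
    (\<forall>e\<in>edges C. 0 \<le> Poly_Mapping.lookup y e)"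
proof -
  let ?y = "Poly_Mapping.lookup y"
  have sub: "in_edges C g \<subseteq> edges C" "out_edges C g \<subseteq> edges C" for g
    by (auto simp: in_edges_def out_edges_def)
  have root: "(\<Sum>f\<in>edges C. Sy_coeff C Root f * ?y f) = sum ?y (in_edges C (outgate C))"
    using sum_of_bool_mult[OF assms sub(1)] by simp
  have oreq: "(\<Sum>f\<in>edges C. Sy_coeff C (Or_Eq g) f * ?y f)
      = sum ?y (in_edges C g) - sum ?y (out_edges C g)" for g
    using sum_of_bool_mult[OF assms sub(1)] sum_of_bool_mult[OF assms sub(2)]
    by (simp add: left_diff_distrib sum_subtractf)
  have andeq: "(\<Sum>f\<in>edges C. Sy_coeff C (And_Eq e) f * ?y f) = ?y e - sum ?y (out_edges C g)"
    if "e \<in> in_edges C g" for e g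
  proof -
    have "e \<in> edges C" "snd e = g"
      using that by (auto simp: in_edges_def)
    then show ?thesis
      using sum_of_bool_mult[OF assms, of "{e}" ?y] sum_of_bool_mult[OF assms sub(2), of g ?y]
      by (simp add: left_diff_distrib sum_subtractf)
  qed
  show ?thesis
    by (auto simp: Py_def solutions_def Sy_def ball_Un root oreq andeq simp del: Sy_coeff.simps)
qed

end

theory Submission
  imports Defs
begin

text \<open>
  Read from the output gate downwards, a point of \<open>Py C\<close> is a unit of demand placed at the
  output: an \<open>\<or>\<close>-gate distributes its demand over its inputs, an \<open>\<and>\<close>-gate passes a full copy
  of its demand to every input. The integral points in which each \<open>\<or>\<close>-gate sends everything to a
  single input are the certificates of the circuit, counted with multiplicity, and both claims
  reduce to statements about them.

  For total dual integrality, a dual vector assigns a price to every edge, the same one to all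
  edges into an \<open>\<or>\<close>-gate. The price of an \<open>\<or>\<close>-gate is that common price, the price of an \<open>\<and>\<close>-gate
  is the sum of the prices of its input edges, and feasibility says exactly that the price of an
  edge covers its weight under \<open>c\<close> plus the price of its source (\<open>dual_feasible_Sy_iff\<close>).
  Dynamic programming (the best value of a certificate below each gate: a maximum at
  \<open>\<or>\<close>-gates, a sum at \<open>\<and>\<close>-gates) yields feasible prices that are integral for integral \<open>c\<close>, and
  induction along the edges shows that no feasible dual vector has lower gate prices
  (\<open>gate_price_ge_best_value\<close>). As the dual objective is the price of the output gate, these
  prices are optimal.

  For integrality, let \<open>y\<close> be a solution. If every \<open>\<or>\<close>-gate selects an input edge on which \<open>y\<close> is
  positive whenever there is one, the resulting certificate is an integral solution
  supported inside the support of \<open>y\<close> (\<open>integral_solution_in_support\<close>). The largest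
  possible multiple of it is split off from \<open>y\<close>; what remains is, after rescaling, a solution
  with smaller support, and induction writes \<open>y\<close> as a convex combination of integral
  solutions (\<open>integral_polyhedron_solutionsI\<close>).
\<close>

section \<open>Integrality by peeling off integral solutions\<close>

lemma lookup_scaleR:
  fixes y :: "'x \<Rightarrow>\<^sub>0 real"
  shows "Poly_Mapping.lookup (r *\<^sub>R y) x = r * Poly_Mapping.lookup y x"
proof -
  have "finite {i. r *\<^sub>R Poly_Mapping.lookup y i \<noteq> 0}"
    by (rule finite_subset[of _ "Poly_Mapping.keys y"]) (auto simp: in_keys_iff)
  then show ?thesis by (simp add: scaleR_poly_mapping_def)
qed

lemma solutions_nonneg:
  assumes "y \<in> solutions S"
  shows "0 \<le> Poly_Mapping.lookup y x"
proof (cases "x \<in> unknowns S")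
  case True
  then show ?thesis using assms by (simp add: solutions_def)
next
  case False
  moreover have "Poly_Mapping.keys y \<subseteq> unknowns S" using assms by (simp add: solutions_def)
  ultimately have "x \<notin> Poly_Mapping.keys y" by blast
  then show ?thesis by (simp add: in_keys_iff)
qed

lemma convex_solutions:
  fixes S :: "('r, 'x) linsys"
  shows "convex (solutions S)"
proof (rule convexI)
  fix y w :: "'x \<Rightarrow>\<^sub>0 real" and u v :: real
  assume y: "y \<in> solutions S" and w: "w \<in> solutions S" and uv: "0 \<le> u" "0 \<le> v" "u + v = 1"
  have lk: "Poly_Mapping.lookup (u *\<^sub>R y + v *\<^sub>R w) x
      = u * Poly_Mapping.lookup y x + v * Poly_Mapping.lookup w x" for x
    by (simp add: lookup_add lookup_scaleR)
  have "(\<Sum>x\<in>unknowns S. coeff S r x * Poly_Mapping.lookup (u *\<^sub>R y + v *\<^sub>R w) x) = rhs S r"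
    if "r \<in> eqs S" for r
  proof -
    have "(\<Sum>x\<in>unknowns S. coeff S r x * Poly_Mapping.lookup (u *\<^sub>R y + v *\<^sub>R w) x)
        = u * (\<Sum>x\<in>unknowns S. coeff S r x * Poly_Mapping.lookup y x)
          + v * (\<Sum>x\<in>unknowns S. coeff S r x * Poly_Mapping.lookup w x)"
      unfolding lk sum_distrib_left sum.distrib[symmetric]
      by (rule sum.cong) (auto simp: algebra_simps)
    also have "\<dots> = (u + v) * rhs S r"
      using y w that by (simp add: solutions_def algebra_simps)
    finally show ?thesis using uv by simp
  qed
  moreover have "Poly_Mapping.keys (u *\<^sub>R y + v *\<^sub>R w) \<subseteq> unknowns S"
  proof
    fix x assume "x \<in> Poly_Mapping.keys (u *\<^sub>R y + v *\<^sub>R w)"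
    then have "x \<in> Poly_Mapping.keys y \<or> x \<in> Poly_Mapping.keys w"
      by (auto simp: in_keys_iff lk)
    moreover have "Poly_Mapping.keys y \<subseteq> unknowns S" "Poly_Mapping.keys w \<subseteq> unknowns S"
      using y w by (simp_all add: solutions_def)
    ultimately show "x \<in> unknowns S" by blast
  qed
  ultimately show "u *\<^sub>R y + v *\<^sub>R w \<in> solutions S"
    using y w uv by (simp add: solutions_def lk)
qed

text \<open>
  The hypothesis on \<open>u\<close> and \<open>w\<close> says that no solution dominates another one; it guarantees that a
  solution cannot contain a full copy of an integral solution \<open>w\<close> unless it is equal to \<open>w\<close>.
  Otherwise the largest multiple of \<open>w\<close> that fits below \<open>y\<close> has a factor less than \<open>1\<close>, and its
  removal annihilates a coordinate of \<open>y\<close>, so induction on the size of the support applies to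
  the rescaled remainder.
\<close>

lemma integral_polyhedron_solutionsI:
  fixes S :: "('r, 'x) linsys"
  assumes no_dominance: "\<And>u w. u \<in> solutions S \<Longrightarrow> w \<in> solutions S \<Longrightarrow>
      (\<And>x. x \<in> unknowns S \<Longrightarrow> Poly_Mapping.lookup w x \<le> Poly_Mapping.lookup u x) \<Longrightarrow> u = w"
    and support: "\<And>y. y \<in> solutions S \<Longrightarrow> \<exists>w\<in>solutions S.
      (\<forall>x. Poly_Mapping.lookup w x \<in> \<int>) \<and> Poly_Mapping.keys w \<subseteq> Poly_Mapping.keys y"
  shows "integral_polyhedron (solutions S)"
proof -
  define I where "I = {y \<in> solutions S. \<forall>x. Poly_Mapping.lookup y x \<in> \<int>}"
  have "y \<in> convex hull I" if "y \<in> solutions S" for y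
    using that
  proof (induction "card (Poly_Mapping.keys y)" arbitrary: y rule: less_induct)
    case less
    let ?y = "Poly_Mapping.lookup y"
    obtain w where w: "w \<in> solutions S" "\<forall>x. Poly_Mapping.lookup w x \<in> \<int>"
      and keys: "Poly_Mapping.keys w \<subseteq> Poly_Mapping.keys y"
      using support[OF less.prems] by blast
    let ?w = "Poly_Mapping.lookup w"
    have wI: "w \<in> convex hull I"
      using w by (intro hull_inc) (simp add: I_def)
    show ?case
    proof (cases "\<forall>x\<in>unknowns S. ?w x \<le> ?y x")
      case True
      then show ?thesis using no_dominance[OF less.prems w(1)] wI by simp
    next
      case False
      then obtain x0 where x0: "x0 \<in> unknowns S" "?y x0 < ?w x0" by (auto simp: not_le)
      have nonneg: "0 \<le> ?y x" "0 \<le> ?w x" for x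
        using solutions_nonneg[OF less.prems] solutions_nonneg[OF w(1)] by blast+
      have pos: "0 < ?w x" "0 < ?y x" if "x \<in> Poly_Mapping.keys w" for x
        using that keys nonneg[of x] by (auto simp: in_keys_iff less_le)
      have x0_key: "x0 \<in> Poly_Mapping.keys w"
        using x0 nonneg[of x0] by (auto simp: in_keys_iff)
      define ratio where "ratio = (\<lambda>x. ?y x / ?w x)"
      obtain x1 where x1: "x1 \<in> Poly_Mapping.keys w"
        and x1_min: "\<And>x. x \<in> Poly_Mapping.keys w \<Longrightarrow> ratio x1 \<le> ratio x"
        using arg_min_if_finite[of "Poly_Mapping.keys w" ratio] x0_key
        by (metis empty_iff finite_keys linorder_not_le)
      \<comment> \<open>The largest multiple of \<open>w\<close> that fits below \<open>y\<close>; it exhausts the coordinate \<open>x1\<close>.\<close>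
      define t where "t = ratio x1"
      have t_pos: "0 < t" using pos[OF x1] by (simp add: t_def ratio_def)
      have t_less: "t < 1"
      proof -
        have "ratio x0 < 1" using x0(2) pos[OF x0_key] by (simp add: ratio_def)
        then show ?thesis using x1_min[OF x0_key] by (simp add: t_def)
      qed
      have fits: "t * ?w x \<le> ?y x" for x
        using x1_min[of x] pos[of x] nonneg[of x] unfolding t_def[symmetric]
        by (cases "x \<in> Poly_Mapping.keys w") (auto simp: ratio_def field_simps in_keys_iff)
      define y' where "y' = (1 / (1 - t)) *\<^sub>R (y - t *\<^sub>R w)"
      have lk: "Poly_Mapping.lookup y' x = (?y x - t * ?w x) / (1 - t)" for x
        by (simp add: y'_def lookup_minus lookup_scaleR)
      have keys': "Poly_Mapping.keys y' \<subset> Poly_Mapping.keys y"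
      proof
        show "Poly_Mapping.keys y' \<subseteq> Poly_Mapping.keys y"
          using keys by (auto simp: in_keys_iff lk subset_iff)
        have "x1 \<notin> Poly_Mapping.keys y'"
          using pos[OF x1] by (simp add: in_keys_iff lk t_def ratio_def)
        then show "Poly_Mapping.keys y' \<noteq> Poly_Mapping.keys y" using x1 keys by blast
      qed
      have eq: "(\<Sum>x\<in>unknowns S. coeff S r x * Poly_Mapping.lookup y' x) = rhs S r"
        if "r \<in> eqs S" for r
      proof -
        have "(\<Sum>x\<in>unknowns S. coeff S r x * Poly_Mapping.lookup y' x)
          = ((\<Sum>x\<in>unknowns S. coeff S r x * ?y x)
              - t * (\<Sum>x\<in>unknowns S. coeff S r x * ?w x)) / (1 - t)"
          unfolding lk sum_distrib_left sum_subtractf[symmetric] sum_divide_distrib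
          by (rule sum.cong) (auto simp: algebra_simps)
        also have "\<dots> = (rhs S r - t * rhs S r) / (1 - t)"
          using less.prems w(1) that by (simp add: solutions_def)
        also have "\<dots> = rhs S r" using t_less by (simp add: field_simps)
        finally show ?thesis .
      qed
      have "Poly_Mapping.keys y' \<subseteq> unknowns S"
      proof -
        have "Poly_Mapping.keys y \<subseteq> unknowns S" using less.prems by (simp add: solutions_def)
        then show ?thesis using keys' by blast
      qed
      then have "y' \<in> solutions S"
        unfolding solutions_def using eq fits t_less by (simp add: lk)
      moreover have "card (Poly_Mapping.keys y') < card (Poly_Mapping.keys y)"
        using keys' by (simp add: psubset_card_mono)
      ultimately have "y' \<in> convex hull I" using less.hyps by blast
      then have "t *\<^sub>R w + (1 - t) *\<^sub>R y' \<in> convex hull I"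
        using wI t_pos t_less by (intro convexD[OF convex_convex_hull]) auto
      moreover have "t *\<^sub>R w + (1 - t) *\<^sub>R y' = y"
        using t_less by (simp add: y'_def)
      ultimately show ?thesis by simp
    qed
  qed
  moreover have "convex hull I \<subseteq> solutions S"
    by (rule hull_minimal) (auto simp: I_def convex_solutions)
  ultimately show ?thesis
    unfolding integral_polyhedron_def I_def[symmetric] by blast
qed

section \<open>Circuits as flow networks\<close>

locale or_rooted_circuit =
  fixes C :: "('g, 'v) circuit"
  assumes nnf: "nnf_circuit C"
    and root_Or: "label C (outgate C) = Or_Gate"
    and root_sink: "out_edges C (outgate C) = {}"
begin

lemma finite_gates: "finite (gates C)"
  and edges_gates: "edges C \<subseteq> gates C \<times> gates C"
  and root_gate: "outgate C \<in> gates C"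
  using nnf by (auto simp: nnf_circuit_def)

lemma finite_edges: "finite (edges C)"
  using edges_gates finite_gates by (meson finite_SigmaI finite_subset)

lemma finite_in_edges: "finite (in_edges C g)" and finite_out_edges: "finite (out_edges C g)"
  using finite_edges by (simp_all add: in_edges_def out_edges_def)

lemma wf_edges: "wf (edges C)" and wf_edges_converse: "wf ((edges C)\<inverse>)"
  using nnf finite_edges
  by (simp_all add: nnf_circuit_def finite_acyclic_wf finite_acyclic_wf_converse)

lemma edge_target_label:
  assumes "(h, g) \<in> edges C"
  shows "label C g = And_Gate \<or> label C g = Or_Gate"
proof -
  have "in_edges C g \<noteq> {}" "g \<in> gates C"
    using assms edges_gates by (auto simp: in_edges_def)
  moreover have "if in_edges C g = {} then label C g \<in> input_labels (circ_vars C)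
      else label C g \<in> {And_Gate, Or_Gate}"
    using nnf \<open>g \<in> gates C\<close> unfolding nnf_circuit_def by blast
  ultimately show ?thesis by simp
qed

lemma Or_gate_has_input:
  assumes "g \<in> gates C" "label C g = Or_Gate"
  shows "in_edges C g \<noteq> {}"
proof
  assume "in_edges C g = {}"
  then have "label C g \<in> input_labels (circ_vars C)" using nnf assms(1) by (simp add: nnf_circuit_def)
  then show False using assms(2) by (auto simp: input_labels_def)
qed

section \<open>Prices: the dual program\<close>

definition edge_price :: "('g eq_index \<Rightarrow> real) \<Rightarrow> 'g \<times> 'g \<Rightarrow> real" where
  "edge_price z e = (if label C (snd e) = And_Gate then z (And_Eq e)
     else if snd e = outgate C then z Root else z (Or_Eq (snd e)))"

definition gate_price :: "('g eq_index \<Rightarrow> real) \<Rightarrow> 'g \<Rightarrow> real" where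
  "gate_price z g = (if label C g = And_Gate then (\<Sum>e\<in>in_edges C g. z (And_Eq e))
     else if g = outgate C then z Root
     else if label C g = Or_Gate then z (Or_Eq g) else 0)"

abbreviation Or_rows :: "'g set" where
  "Or_rows \<equiv> {g \<in> gates C. label C g = Or_Gate \<and> g \<noteq> outgate C}"

abbreviation And_rows :: "('g \<times> 'g) set" where
  "And_rows \<equiv> (\<Union>g\<in>{g \<in> gates C. label C g = And_Gate}. in_edges C g)"

lemma And_rows_alt: "And_rows = {e \<in> edges C. label C (snd e) = And_Gate}"
  using edges_gates by (auto simp: in_edges_def)

lemma finite_And_rows: "finite And_rows"
  unfolding And_rows_alt using finite_edges by simp

text \<open>
  The column of an edge has its positive entry in the single row that governs the edge at its
  target, and its negative entries in the rows that belong to its source.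
\<close>

lemma dual_column:
  assumes "f \<in> edges C"
  shows "(\<Sum>r\<in>eqs (Sy C). z r * Sy_coeff C r f) = edge_price z f - gate_price z (fst f)"
proof -
  obtain h g where f: "f = (h, g)" by fastforce
  have hg: "h \<in> gates C" "g \<in> gates C" "h \<noteq> outgate C"
    using assms f edges_gates root_sink by (auto simp: out_edges_def)
  have lab: "label C g = And_Gate \<or> label C g = Or_Gate"
    using edge_target_label assms f by simp
  have in_iff: "f \<in> in_edges C k \<longleftrightarrow> k = g" and out_iff: "f \<in> out_edges C k \<longleftrightarrow> k = h" for k
    using assms f by (auto simp: in_edges_def out_edges_def)
  have finO: "finite Or_rows" using finite_gates by simp
  have "(\<Sum>r\<in>eqs (Sy C). z r * Sy_coeff C r f) = z Root * Sy_coeff C Root f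
      + (\<Sum>k\<in>Or_rows. z (Or_Eq k) * Sy_coeff C (Or_Eq k) f)
      + (\<Sum>e\<in>And_rows. z (And_Eq e) * Sy_coeff C (And_Eq e) f)"
  proof -
    have "(\<Sum>r\<in>eqs (Sy C). z r * Sy_coeff C r f)
      = (\<Sum>r\<in>{Root} \<union> Or_Eq ` Or_rows. z r * Sy_coeff C r f)
        + (\<Sum>r\<in>And_Eq ` And_rows. z r * Sy_coeff C r f)"
      unfolding Sy_def linsys.simps using finO finite_And_rows
      by (intro sum.union_disjoint) auto
    also have "(\<Sum>r\<in>{Root} \<union> Or_Eq ` Or_rows. z r * Sy_coeff C r f)
      = z Root * Sy_coeff C Root f + (\<Sum>r\<in>Or_Eq ` Or_rows. z r * Sy_coeff C r f)"
      using finO by (subst sum.union_disjoint) auto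
    finally show ?thesis
      by (simp add: sum.reindex inj_on_def del: Sy_coeff.simps)
  qed
  also have "z Root * Sy_coeff C Root f = (if g = outgate C then z Root else 0)"
    by (simp add: in_iff)
  also have "(\<Sum>k\<in>Or_rows. z (Or_Eq k) * Sy_coeff C (Or_Eq k) f)
      = (if g \<in> Or_rows then z (Or_Eq g) else 0) - (if h \<in> Or_rows then z (Or_Eq h) else 0)"
  proof -
    have "(\<Sum>k\<in>Or_rows. z (Or_Eq k) * Sy_coeff C (Or_Eq k) f)
      = (\<Sum>k\<in>Or_rows. if k = g then z (Or_Eq k) else 0)
        - (\<Sum>k\<in>Or_rows. if k = h then z (Or_Eq k) else 0)"
      unfolding sum_subtractf[symmetric] by (rule sum.cong) (auto simp: in_iff out_iff)
    then show ?thesis unfolding sum.delta[OF finO] .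
  qed
  also have "(\<Sum>e\<in>And_rows. z (And_Eq e) * Sy_coeff C (And_Eq e) f)
      = (if label C g = And_Gate then z (And_Eq f) else 0)
        - (if label C h = And_Gate then \<Sum>e\<in>in_edges C h. z (And_Eq e) else 0)"
  proof -
    have "(\<Sum>e\<in>And_rows. z (And_Eq e) * Sy_coeff C (And_Eq e) f)
      = (\<Sum>e\<in>And_rows. if e = f then z (And_Eq e) else 0)
        - (\<Sum>e\<in>And_rows. if snd e = h then z (And_Eq e) else 0)"
      unfolding sum_subtractf[symmetric] by (rule sum.cong) (auto simp: out_iff)
    also have "(\<Sum>e\<in>And_rows. if e = f then z (And_Eq e) else 0)
      = (if label C g = And_Gate then z (And_Eq f) else 0)"
      unfolding sum.delta[OF finite_And_rows] using assms f by (simp add: And_rows_alt)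
    also have "(\<Sum>e\<in>And_rows. if snd e = h then z (And_Eq e) else 0)
      = (\<Sum>e\<in>{e \<in> And_rows. snd e = h}. z (And_Eq e))"
      using finite_And_rows by (rule sum.inter_filter[symmetric])
    also have "{e \<in> And_rows. snd e = h} = (if label C h = And_Gate then in_edges C h else {})"
      unfolding And_rows_alt by (auto simp: in_edges_def)
    finally show ?thesis by (simp split: if_splits)
  qed
  finally show ?thesis
    using lab hg root_Or by (auto simp: edge_price_def gate_price_def f)
qed

lemma dual_feasible_Sy_iff:
  "z \<in> dual_feasible (Sy C) c \<longleftrightarrow>
     (\<forall>e\<in>edges C. of_int (c e) + gate_price z (fst e) \<le> edge_price z e)"
  using dual_column[of _ z]
  by (auto simp: dual_feasible_def Sy_def le_diff_eq)

lemma dual_value_Sy: "dual_value (Sy C) z = z Root"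
proof -
  have "dual_value (Sy C) z = (\<Sum>r\<in>eqs (Sy C). if r = Root then z r else 0)"
    unfolding dual_value_def by (rule sum.cong) (auto simp: Sy_def)
  moreover have "finite (eqs (Sy C))" "Root \<in> eqs (Sy C)"
    using finite_gates finite_And_rows by (auto simp: Sy_def)
  ultimately show ?thesis by simp
qed

text \<open>The largest weight \<open>c\<close> of a certificate below a gate, computed bottom-up.\<close>

lemma best_value_exists:
  fixes c :: "'g \<times> 'g \<Rightarrow> int"
  obtains W :: "'g \<Rightarrow> int" where
    "\<And>g. W g = (if label C g = Or_Gate then Max ((\<lambda>e. c e + W (fst e)) ` in_edges C g)
       else if label C g = And_Gate then \<Sum>e\<in>in_edges C g. c e + W (fst e) else 0)"
proof -
  define F where "F = (\<lambda>(W :: 'g \<Rightarrow> int) g.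
    if label C g = Or_Gate then Max ((\<lambda>e. c e + W (fst e)) ` in_edges C g)
    else if label C g = And_Gate then \<Sum>e\<in>in_edges C g. c e + W (fst e) else 0)"
  have "F V g = F W g" if "\<And>h. (h, g) \<in> edges C \<Longrightarrow> V h = W h" for V W g
  proof -
    have "(\<lambda>e. c e + V (fst e)) ` in_edges C g = (\<lambda>e. c e + W (fst e)) ` in_edges C g"
      using that by (intro image_cong) (auto simp: in_edges_def)
    moreover have "(\<Sum>e\<in>in_edges C g. c e + V (fst e)) = (\<Sum>e\<in>in_edges C g. c e + W (fst e))"
      using that by (intro sum.cong) (auto simp: in_edges_def)
    ultimately show ?thesis by (simp add: F_def)
  qed
  then have "adm_wf (edges C) F" unfolding adm_wf_def by blast
  from wfrec_fixpoint[OF wf_edges this]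
  have "wfrec (edges C) F g = F (wfrec (edges C) F) g" for g by metis
  then show thesis unfolding F_def by (rule that)
qed

text \<open>
  Weak duality, gate by gate: for prices, feasibility turns the recursion of the best values into
  an inequality, and both maximum and sum are monotone in the values at the inputs.
\<close>

lemma gate_price_ge_best_value:
  fixes c :: "'g \<times> 'g \<Rightarrow> int" and W :: "'g \<Rightarrow> int"
  assumes W: "\<And>g. W g = (if label C g = Or_Gate then Max ((\<lambda>e. c e + W (fst e)) ` in_edges C g)
       else if label C g = And_Gate then \<Sum>e\<in>in_edges C g. c e + W (fst e) else 0)"
    and feas: "z \<in> dual_feasible (Sy C) c"
    and "g \<in> gates C"
  shows "of_int (W g) \<le> gate_price z g"
  using wf_edges \<open>g \<in> gates C\<close>
proof (induction g rule: wf_induct_rule)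
  case (less g)
  have edge: "of_int (c e + W (fst e)) \<le> edge_price z e" if e: "e \<in> in_edges C g" for e
  proof -
    have "(fst e, g) \<in> edges C" "fst e \<in> gates C" "e \<in> edges C"
      using e edges_gates by (auto simp: in_edges_def)
    moreover have "of_int (c e) + gate_price z (fst e) \<le> edge_price z e"
      using feas \<open>e \<in> edges C\<close> by (simp add: dual_feasible_Sy_iff)
    ultimately show ?thesis using less.IH by fastforce
  qed
  have target: "snd e = g" if "e \<in> in_edges C g" for e
    using that by (simp add: in_edges_def)
  consider "label C g = Or_Gate" | "label C g = And_Gate"
    | "label C g \<noteq> Or_Gate" "label C g \<noteq> And_Gate" by blast
  then show ?case
  proof cases
    case 1
    have "Max ((\<lambda>e. c e + W (fst e)) ` in_edges C g) \<in> (\<lambda>e. c e + W (fst e)) ` in_edges C g"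
      using Or_gate_has_input[OF less.prems 1] finite_in_edges by (intro Max_in) auto
    then obtain e where e: "e \<in> in_edges C g" "W g = c e + W (fst e)"
      using W[of g] 1 by auto
    moreover have "edge_price z e = gate_price z g"
      using 1 target[OF e(1)] by (simp add: edge_price_def gate_price_def)
    ultimately show ?thesis using edge by metis
  next
    case 2
    then have "of_int (W g) = (\<Sum>e\<in>in_edges C g. real_of_int (c e + W (fst e)))"
      using W[of g] by simp
    also have "\<dots> \<le> (\<Sum>e\<in>in_edges C g. edge_price z e)"
      using edge by (rule sum_mono)
    also have "\<dots> = gate_price z g"
      using 2 target by (simp add: edge_price_def gate_price_def)
    finally show ?thesis .
  next
    case 3
    then show ?thesis using W[of g] root_Or by (auto simp: gate_price_def)
  qed
qed

lemma integral_dual_optimum: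
  fixes c :: "'g \<times> 'g \<Rightarrow> int"
  shows "\<exists>z. dual_optimal (Sy C) c z \<and> (\<forall>r\<in>eqs (Sy C). z r \<in> \<int>)"
proof -
  obtain W :: "'g \<Rightarrow> int" where
    W: "\<And>g. W g = (if label C g = Or_Gate then Max ((\<lambda>e. c e + W (fst e)) ` in_edges C g)
       else if label C g = And_Gate then \<Sum>e\<in>in_edges C g. c e + W (fst e) else 0)"
    by (rule best_value_exists[of c]) blast
  define z :: "'g eq_index \<Rightarrow> real" where
    "z = (\<lambda>r. of_int (case r of Root \<Rightarrow> W (outgate C) | Or_Eq g \<Rightarrow> W g
       | And_Eq e \<Rightarrow> c e + W (fst e)))"
  have gate: "gate_price z g = of_int (W g)" for g
    using W[of g] root_Or by (cases "g = outgate C") (simp_all add: gate_price_def z_def)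
  have "of_int (c e) + gate_price z (fst e) \<le> edge_price z e" if e: "e \<in> edges C" for e
  proof (cases "label C (snd e) = And_Gate")
    case True
    then show ?thesis unfolding gate by (simp add: edge_price_def z_def)
  next
    case False
    then have Or: "label C (snd e) = Or_Gate"
      using e edge_target_label[of "fst e" "snd e"] by simp
    have "c e + W (fst e) \<le> W (snd e)"
      using W[of "snd e"] Or e finite_in_edges by (auto simp: in_edges_def intro!: Max_ge)
    then have "real_of_int (c e) + real_of_int (W (fst e)) \<le> real_of_int (W (snd e))" by linarith
    moreover have "edge_price z e = real_of_int (W (snd e))"
      using False by (simp add: edge_price_def z_def)
    ultimately show ?thesis unfolding gate by simp
  qed
  then have "z \<in> dual_feasible (Sy C) c" by (simp add: dual_feasible_Sy_iff)
  moreover have "dual_value (Sy C) z \<le> dual_value (Sy C) z'"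
    if "z' \<in> dual_feasible (Sy C) c" for z'
    using gate_price_ge_best_value[OF W that root_gate] root_Or
    by (simp add: dual_value_Sy gate_price_def z_def)
  ultimately have "dual_optimal (Sy C) c z" by (simp add: dual_optimal_def)
  moreover have "\<forall>r\<in>eqs (Sy C). z r \<in> \<int>" by (simp add: z_def)
  ultimately show ?thesis by blast
qed

lemma rational_Sy: "rational_linsys (Sy C)"
proof -
  have "Sy_coeff C r f \<in> \<rat>" for r f by (cases r) (simp_all add: of_bool_def)
  then show ?thesis
    using finite_gates finite_And_rows finite_edges by (simp add: rational_linsys_def Sy_def)
qed

section \<open>Certificates: integral solutions\<close>

text \<open>
  At an \<open>\<and>\<close>-gate the flow out of the gate determines the flow on each edge into it, at an
  \<open>\<or>\<close>-gate the sum of these flows (at the output, this sum is fixed to \<open>1\<close>). Hence solutions of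
  which one dominates the other agree on all edges into a gate once they agree on the edges out of
  it.
\<close>

lemma Py_no_dominance:
  assumes y: "y \<in> Py C" and w: "w \<in> Py C"
    and le: "\<And>e. e \<in> edges C \<Longrightarrow> Poly_Mapping.lookup w e \<le> Poly_Mapping.lookup y e"
  shows "y = w"
proof -
  let ?y = "Poly_Mapping.lookup y" and ?w = "Poly_Mapping.lookup w"
  note Y = y[unfolded mem_Py_iff[OF finite_edges]] and W = w[unfolded mem_Py_iff[OF finite_edges]]
  have "\<forall>e\<in>in_edges C g. ?y e = ?w e" for g
    using wf_edges_converse
  proof (induction g rule: wf_induct_rule)
    case (less g)
    have out: "sum ?y (out_edges C g) = sum ?w (out_edges C g)"
      using less.IH by (intro sum.cong) (auto simp: out_edges_def in_edges_def)
    show ?case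
    proof (cases "in_edges C g = {}")
      case False
      then have g: "g \<in> gates C" "label C g = And_Gate \<or> label C g = Or_Gate"
        using edges_gates edge_target_label by (auto simp: in_edges_def)
      show ?thesis
      proof (cases "label C g = And_Gate")
        case True
        then show ?thesis using Y W g out by auto
      next
        case False
        then have "sum ?w (in_edges C g) = sum ?y (in_edges C g)"
          using Y W g out by (cases "g = outgate C") auto
        moreover have "\<And>e. e \<in> in_edges C g \<Longrightarrow> ?w e \<le> ?y e"
          using le by (simp add: in_edges_def)
        ultimately show ?thesis
          using finite_in_edges sum_mono_inv[of ?w "in_edges C g" ?y] by metis
      qed
    qed simp
  qed
  then have "?y e = ?w e" if "e \<in> edges C" for e
    using that by (cases e) (auto simp: in_edges_def)
  moreover have "?y e = ?w e" if "e \<notin> edges C" for e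
    using that Y W by (metis in_keys_iff subsetD)
  ultimately show ?thesis by (intro poly_mapping_eqI) blast
qed

text \<open>
  The number of copies of a gate in the certificate given by the choices \<open>s\<close>, which is the number
  of paths from the gate to the output on which every \<open>\<or>\<close>-gate is entered through its chosen edge.
\<close>

lemma multiplicity_exists:
  fixes s :: "'g \<Rightarrow> 'g \<times> 'g"
  obtains n :: "'g \<Rightarrow> nat" where
    "\<And>g. n g = (if g = outgate C then 1
       else \<Sum>e\<in>out_edges C g. if label C (snd e) = Or_Gate \<and> s (snd e) \<noteq> e then 0 else n (snd e))"
proof -
  define F where "F = (\<lambda>(n :: 'g \<Rightarrow> nat) g. if g = outgate C then 1
    else \<Sum>e\<in>out_edges C g. if label C (snd e) = Or_Gate \<and> s (snd e) \<noteq> e then 0 else n (snd e))"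
  have "F m g = F n g" if "\<And>k. (k, g) \<in> (edges C)\<inverse> \<Longrightarrow> m k = n k" for m n g
    unfolding F_def using that by (intro if_cong sum.cong refl) (auto simp: out_edges_def)
  then have "adm_wf ((edges C)\<inverse>) F" unfolding adm_wf_def by blast
  from wfrec_fixpoint[OF wf_edges_converse this]
  have "wfrec ((edges C)\<inverse>) F g = F (wfrec ((edges C)\<inverse>) F) g" for g by metis
  then show thesis unfolding F_def by (rule that)
qed

lemma integral_solution_in_support:
  assumes y: "y \<in> Py C"
  shows "\<exists>w\<in>Py C. (\<forall>e. Poly_Mapping.lookup w e \<in> \<int>) \<and> Poly_Mapping.keys w \<subseteq> Poly_Mapping.keys y"
proof -
  let ?y = "Poly_Mapping.lookup y"
  note Y = y[unfolded mem_Py_iff[OF finite_edges]]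
  have nonneg: "0 \<le> ?y e" for e
    using Y by (metis in_keys_iff order_refl subsetD)
  \<comment> \<open>Gates without demand in \<open>y\<close> need a choice as well, but an arbitrary one.\<close>
  have "\<exists>e\<in>in_edges C g. 0 < sum ?y (in_edges C g) \<longrightarrow> 0 < ?y e"
    if g: "g \<in> gates C" "label C g = Or_Gate" for g
    using Or_gate_has_input[OF g] sum_nonpos[of "in_edges C g" ?y] by (metis ex_in_conv not_le)
  then obtain s where s: "\<And>g. g \<in> gates C \<Longrightarrow> label C g = Or_Gate \<Longrightarrow>
      s g \<in> in_edges C g \<and> (0 < sum ?y (in_edges C g) \<longrightarrow> 0 < ?y (s g))"
    by metis
  obtain n :: "'g \<Rightarrow> nat" where n: "\<And>g. n g = (if g = outgate C then 1
      else \<Sum>e\<in>out_edges C g. if label C (snd e) = Or_Gate \<and> s (snd e) \<noteq> e then 0 else n (snd e))"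
    by (rule multiplicity_exists[of s]) blast
  define m where "m = (\<lambda>e. if e \<in> edges C \<and> (label C (snd e) = Or_Gate \<longrightarrow> s (snd e) = e)
      then real (n (snd e)) else 0)"
  have out: "sum m (out_edges C g) = real (n g)" if "g \<noteq> outgate C" for g
  proof -
    have "sum m (out_edges C g) = (\<Sum>e\<in>out_edges C g.
        real (if label C (snd e) = Or_Gate \<and> s (snd e) \<noteq> e then 0 else n (snd e)))"
      by (rule sum.cong) (auto simp: m_def out_edges_def)
    also have "\<dots> = real (n g)" using n[of g] that by simp
    finally show ?thesis .
  qed
  have Or_in: "sum m (in_edges C g) = real (n g)" if g: "g \<in> gates C" "label C g = Or_Gate" for g
  proof -
    have "sum m (in_edges C g) = (\<Sum>e\<in>in_edges C g. if e = s g then real (n g) else 0)"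
    proof (intro sum.cong refl)
      fix e assume "e \<in> in_edges C g"
      then have "e \<in> edges C" "snd e = g" by (simp_all add: in_edges_def)
      then show "m e = (if e = s g then real (n g) else 0)" using g by (auto simp: m_def)
    qed
    then show ?thesis using s[OF g] finite_in_edges by simp
  qed
  have And_in: "m e = real (n g)" if "label C g = And_Gate" "e \<in> in_edges C g" for e g
    using that by (simp add: m_def in_edges_def)
  \<comment> \<open>Demand reaches a gate in the certificate only where \<open>y\<close> has demand as well.\<close>
  have supp: "\<forall>e\<in>in_edges C g. m e \<noteq> 0 \<longrightarrow> 0 < ?y e" for g
    using wf_edges_converse
  proof (induction g rule: wf_induct_rule)
    case (less g)
    show ?case
    proof (intro ballI impI)
      fix e assume e: "e \<in> in_edges C g" and me: "m e \<noteq> 0"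
      have g: "g \<in> gates C" "label C g = And_Gate \<or> label C g = Or_Gate"
        using e edges_gates edge_target_label[of "fst e" g] by (auto simp: in_edges_def)
      have ng: "n g \<noteq> 0" and se: "label C g = Or_Gate \<longrightarrow> s g = e"
        using me e by (auto simp: m_def in_edges_def split: if_splits)
      have out_pos: "0 < sum ?y (out_edges C g)" if "g \<noteq> outgate C"
      proof -
        have "sum m (out_edges C g) \<noteq> 0" using out[OF that] ng by simp
        then obtain f where f: "f \<in> out_edges C g" "m f \<noteq> 0"
          by (rule sum.not_neutral_contains_not_neutral)
        then have "(snd f, g) \<in> (edges C)\<inverse>" "f \<in> in_edges C (snd f)"
          by (auto simp: out_edges_def in_edges_def)
        then have "0 < ?y f" using less.IH f(2) by blast
        then show ?thesis using f(1) finite_out_edges nonneg by (intro sum_pos2[of _ f]) auto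
      qed
      show "0 < ?y e"
      proof (cases "label C g = And_Gate")
        case True
        then have "g \<noteq> outgate C" using root_Or by auto
        moreover have "?y e = sum ?y (out_edges C g)" using Y g(1) True e by auto
        ultimately show ?thesis using out_pos by simp
      next
        case False
        then have Or: "label C g = Or_Gate" using g(2) by simp
        have "0 < sum ?y (in_edges C g)"
          using Y g(1) Or out_pos by (cases "g = outgate C") auto
        then show ?thesis using s[OF g(1) Or] se Or by simp
      qed
    qed
  qed
  have m_edges: "e \<in> edges C" if "m e \<noteq> 0" for e
    using that by (auto simp: m_def split: if_splits)
  have "finite {e. m e \<noteq> 0}"
    by (rule finite_subset[OF _ finite_edges]) (use m_edges in auto)
  then have lk: "Poly_Mapping.lookup (Abs_poly_mapping m) = m" by simp
  have "Abs_poly_mapping m \<in> Py C"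
    unfolding mem_Py_iff[OF finite_edges] lk
  proof (intro conjI ballI impI)
    show "Poly_Mapping.keys (Abs_poly_mapping m) \<subseteq> edges C"
      using m_edges by (auto simp: in_keys_iff lk)
    show "sum m (in_edges C (outgate C)) = 1"
      using Or_in[OF root_gate root_Or] n[of "outgate C"] by simp
  next
    fix g assume "g \<in> gates C" "label C g = Or_Gate \<and> g \<noteq> outgate C"
    then show "sum m (in_edges C g) - sum m (out_edges C g) = 0" by (simp add: Or_in out)
  next
    fix g e assume "g \<in> gates C" "label C g = And_Gate" "e \<in> in_edges C g"
    moreover have "g \<noteq> outgate C" using \<open>label C g = And_Gate\<close> root_Or by auto
    ultimately show "m e - sum m (out_edges C g) = 0" by (simp add: And_in out)
  qed (simp add: m_def)
  moreover have "Poly_Mapping.keys (Abs_poly_mapping m) \<subseteq> Poly_Mapping.keys y"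
  proof
    fix e assume "e \<in> Poly_Mapping.keys (Abs_poly_mapping m)"
    then have "m e \<noteq> 0" by (simp add: in_keys_iff lk)
    then have "e \<in> in_edges C (snd e)" using m_edges by (simp add: in_edges_def)
    then have "0 < ?y e" using supp \<open>m e \<noteq> 0\<close> by blast
    then show "e \<in> Poly_Mapping.keys y" by (simp add: in_keys_iff)
  qed
  moreover have "\<forall>e. Poly_Mapping.lookup (Abs_poly_mapping m) e \<in> \<int>"
    unfolding lk by (simp add: m_def)
  ultimately show ?thesis by blast
qed

lemma integral_Py: "integral_polyhedron (Py C)"
  unfolding Py_def
proof (rule integral_polyhedron_solutionsI)
  fix u w
  assume "u \<in> solutions (Sy C)" "w \<in> solutions (Sy C)"
    and "\<And>e. e \<in> unknowns (Sy C) \<Longrightarrow> Poly_Mapping.lookup w e \<le> Poly_Mapping.lookup u e"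
  then show "u = w"
    by (intro Py_no_dominance) (simp_all add: Py_def Sy_def)
next
  fix y
  assume "y \<in> solutions (Sy C)"
  then show "\<exists>w\<in>solutions (Sy C). (\<forall>e. Poly_Mapping.lookup w e \<in> \<int>)
      \<and> Poly_Mapping.keys w \<subseteq> Poly_Mapping.keys y"
    using integral_solution_in_support[of y] by (simp add: Py_def)
qed

end

section \<open>Total dual integrality and integrality\<close>

theorem theorem17:
  fixes C :: "('g, 'v) circuit"
  assumes "dnnf C" and "normalized C"
  shows "totally_dual_integral (Sy C) \<and> integral_polyhedron (Py C)"
proof -
  interpret or_rooted_circuit C
    using assms by unfold_locales (auto simp: dnnf_def normalized_def)
  show ?thesis
    using rational_Sy integral_dual_optimum integral_Py by (simp add: totally_dual_integral_def)
qed

end
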